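(* Let $K$ be a finite simplicial complex, let $W:K\rightarrow K\cup\{0\}$ be an admissible discrete vector field over $K$, and let $h:K\rightarrow\mathbb{Z}_{\geq 0}$ be the height function associated to $W$. Then $h$ is a combinatorial Morse function over $K$ with gradient vector field $W$, i.e. $V_h=W$.
   Context: $K$ is identified with its set of (non-empty) simplices. Write $\sigma\prec\tau$ (or $\tau\succ\sigma$) if $\sigma$ is an immediate face of $\tau$ in $K$, i.e. $\sigma$ is a face of $\tau$ and $\dim(\sigma)=\dim(\tau)-1$. A discrete vector field over $K$ is a map $W:K\rightarrow K\cup\{0\}$ such that (W1) if $W(\sigma)\neq 0$ then $\sigma\prec W(\sigma)$; (W2) if $W(\sigma)=W(\sigma')\neq 0$ then $\sigma=\sigma'$; (W3) $W^2=0$, i.e. if $W(\sigma)\neq 0$ then $W(W(\sigma))=0$. A path of index $k$ relative to $W$ is a sequence of $k$-simplices $\sigma_0,\ldots,\sigma_r\in W^{-1}(K)$ such that $\sigma_i\neq\sigma_{i+1}$ and $\sigma_{i+1}\prec W(\sigma_i)$ for all $0\leq i\leq r-1$. It is closed if $\sigma_0=\sigma_r$ and non-stationary if $r>0$. $W$ is admissible if it has no non-stationary closed paths (of any index). A combinatorial Morse function over $K$ is a map $f:K\rightarrow\mathbb{R}$ such that for every $\sigma\in K$: (M1) $|\{\eta\prec\sigma : f(\eta)\geq f(\sigma)\}|\leq 1$ and (M2) $|\{\tau\succ\sigma : f(\tau)\leq f(\sigma)\}|\leq 1$. Its gradient vector field $V_f$ is the discrete vector field given by $V_f(\sigma)=\tau$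 if $\tau\succ\sigma$ and $f(\sigma)\geq f(\tau)$, and $V_f(\sigma)=0$ if there is no such $\tau$. For an admissible $W$, let $\lessdot$ be the relation on $K$ obtained as the transitive closure of the following atomic relations: (1) $\sigma\lessdot\tau$ if $\sigma\prec\tau$; and (2) $\sigma\gtrdot\tau$ (i.e. $\tau\lessdot\sigma$) if $\tau=W(\sigma)$. Write $\sigma\mathbin{\dot{\sim}}\tau$ whenever $\sigma\lessdot\tau$ and $\sigma\gtrdot\tau$. The height function $h:K\rightarrow\mathbb{Z}_{\geq 0}$ associated to $W$ is defined by letting $h(\sigma)$ be the maximum $n\in\mathbb{Z}_{\geq 0}$ for which there exists a chain $\sigma=\sigma_n\gtrdot\sigma_{n-1}\gtrdot\cdots\gtrdot\sigma_0$ in $K$ such that $\sigma_i\mathbin{\dot{\sim}}\sigma_{i+1}$ does not hold for any $0\leq i\leq n-1$. *)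

theory Defs
  imports Complex_Main "HOL-Library.FuncSet"
begin

text \<open>
  An abstract simplicial complex is identified with its set of non-empty simplices, a simplex being
  a finite set of vertices. Simplices are faces of one another by inclusion.
\<close>

definition abstract_simplicial_complex :: "'a set set \<Rightarrow> bool" where
  "abstract_simplicial_complex K \<longleftrightarrow>
     (\<forall>\<sigma>\<in>K. finite \<sigma> \<and> \<sigma> \<noteq> {}) \<and>
     (\<forall>\<sigma>\<in>K. \<forall>\<eta>. \<eta> \<subseteq> \<sigma> \<and> \<eta> \<noteq> {} \<longrightarrow> \<eta> \<in> K)"

text \<open>Integer-valued, so that \<open>simplex_dim \<tau> - 1\<close> is not truncated when \<open>\<tau>\<close> is a vertex.\<close>

definition simplex_dim :: "'a set \<Rightarrow> int" where
  "simplex_dim \<sigma> = int (card \<sigma>) - 1"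

definition immediate_face :: "'a set set \<Rightarrow> 'a set \<Rightarrow> 'a set \<Rightarrow> bool" where
  "immediate_face K \<sigma> \<tau> \<longleftrightarrow>
     \<sigma> \<in> K \<and> \<tau> \<in> K \<and> \<sigma> \<subseteq> \<tau> \<and> simplex_dim \<sigma> = simplex_dim \<tau> - 1"

text \<open>
  A map \<open>K \<rightarrow> K \<union> {0}\<close> is a function into the option type: \<open>None\<close> plays the role of \<open>0\<close> and
  \<open>Some \<tau>\<close> that of \<open>\<tau>\<close>. Values outside \<open>K\<close> are irrelevant.
\<close>

definition discrete_vector_field :: "'a set set \<Rightarrow> ('a set \<Rightarrow> 'a set option) \<Rightarrow> bool" where
  "discrete_vector_field K W \<longleftrightarrow>
     W \<in> K \<rightarrow> insert None (Some ` K) \<and>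
     (\<forall>\<sigma>\<in>K. \<forall>\<tau>. W \<sigma> = Some \<tau> \<longrightarrow> immediate_face K \<sigma> \<tau>) \<and>
     (\<forall>\<sigma>\<in>K. \<forall>\<sigma>'\<in>K. W \<sigma> = W \<sigma>' \<and> W \<sigma> \<noteq> None \<longrightarrow> \<sigma> = \<sigma>') \<and>
     (\<forall>\<sigma>\<in>K. \<forall>\<tau>. W \<sigma> = Some \<tau> \<longrightarrow> W \<tau> = None)"

text \<open>The path is \<open>s 0, \<dots>, s r\<close>; values of \<open>s\<close> beyond \<open>r\<close> are irrelevant.\<close>

definition vf_path ::
  "'a set set \<Rightarrow> ('a set \<Rightarrow> 'a set option) \<Rightarrow> nat \<Rightarrow> nat \<Rightarrow> (nat \<Rightarrow> 'a set) \<Rightarrow> bool" where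
  "vf_path K W k r s \<longleftrightarrow>
     (\<forall>i\<le>r. s i \<in> K \<and> simplex_dim (s i) = int k \<and> W (s i) \<noteq> None) \<and>
     (\<forall>i<r. s i \<noteq> s (Suc i) \<and> immediate_face K (s (Suc i)) (the (W (s i))))"

definition admissible :: "'a set set \<Rightarrow> ('a set \<Rightarrow> 'a set option) \<Rightarrow> bool" where
  "admissible K W \<longleftrightarrow> \<not> (\<exists>k r s. vf_path K W k r s \<and> s 0 = s r \<and> r > 0)"

text \<open>Finiteness is stated explicitly because \<open>card\<close> of an infinite set is \<open>0\<close>.\<close>

definition combinatorial_morse_function :: "'a set set \<Rightarrow> ('a set \<Rightarrow> real) \<Rightarrow> bool" where
  "combinatorial_morse_function K f \<longleftrightarrow>
     (\<forall>\<sigma>\<in>K.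
        finite {\<eta>. immediate_face K \<eta> \<sigma> \<and> f \<eta> \<ge> f \<sigma>} \<and>
        card {\<eta>. immediate_face K \<eta> \<sigma> \<and> f \<eta> \<ge> f \<sigma>} \<le> 1 \<and>
        finite {\<tau>. immediate_face K \<sigma> \<tau> \<and> f \<tau> \<le> f \<sigma>} \<and>
        card {\<tau>. immediate_face K \<sigma> \<tau> \<and> f \<tau> \<le> f \<sigma>} \<le> 1)"

text \<open>For a combinatorial Morse function the definite description below has a unique witness.\<close>

definition gradient_field ::
  "'a set set \<Rightarrow> ('a set \<Rightarrow> real) \<Rightarrow> 'a set \<Rightarrow> 'a set option" where
  "gradient_field K f \<sigma> =
     (if \<exists>\<tau>. immediate_face K \<sigma> \<tau> \<and> f \<sigma> \<ge> f \<tau>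
      then Some (THE \<tau>. immediate_face K \<sigma> \<tau> \<and> f \<sigma> \<ge> f \<tau>)
      else None)"

definition vf_atomic ::
  "'a set set \<Rightarrow> ('a set \<Rightarrow> 'a set option) \<Rightarrow> 'a set \<Rightarrow> 'a set \<Rightarrow> bool" where
  "vf_atomic K W \<sigma> \<tau> \<longleftrightarrow> immediate_face K \<sigma> \<tau> \<or> (\<tau> \<in> K \<and> W \<tau> = Some \<sigma>)"

definition vf_less ::
  "'a set set \<Rightarrow> ('a set \<Rightarrow> 'a set option) \<Rightarrow> 'a set \<Rightarrow> 'a set \<Rightarrow> bool" where
  "vf_less K W = tranclp (vf_atomic K W)"

definition vf_sim ::
  "'a set set \<Rightarrow> ('a set \<Rightarrow> 'a set option) \<Rightarrow> 'a set \<Rightarrow> 'a set \<Rightarrow> bool" where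
  "vf_sim K W \<sigma> \<tau> \<longleftrightarrow> vf_less K W \<sigma> \<tau> \<and> vf_less K W \<tau> \<sigma>"

text \<open>The chain is \<open>c n, \<dots>, c 0\<close>, descending from \<open>c n = \<sigma>\<close>.\<close>

definition vf_height :: "'a set set \<Rightarrow> ('a set \<Rightarrow> 'a set option) \<Rightarrow> 'a set \<Rightarrow> nat" where
  "vf_height K W \<sigma> =
     Max {n. \<exists>c. c n = \<sigma> \<and> (\<forall>i\<le>n. c i \<in> K) \<and>
                 (\<forall>i<n. vf_less K W (c i) (c (Suc i)) \<and> \<not> vf_sim K W (c i) (c (Suc i)))}"

end

theory Submission imports Defs
begin

text \<open>
  The heart of the matter is that an immediate face \<open>\<sigma>\<close> of \<open>\<tau>\<close> is equivalent to \<open>\<tau>\<close> exactly when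
  \<open>W \<sigma> = \<tau>\<close> (\<open>vf_field_iff_less\<close>). Suppose \<open>\<tau>\<close> can be reached from \<open>\<sigma>\<close> by descending steps, each
  of which passes to an immediate face or applies \<open>W\<close>. As \<open>W\<close> cannot be applied twice in a row, a
  walk that drops below \<open>dim \<sigma>\<close> can climb back at most to a simplex of dimension \<open>dim \<sigma>\<close> in the
  image of \<open>W\<close>, where it has to go down again. So a walk from \<open>\<sigma>\<close> that ends one dimension higher
  alternates between the two kinds of steps throughout; once stationary steps are deleted, it is a
  path relative to \<open>W\<close> from \<open>\<sigma>\<close> to some \<open>\<sigma>'\<close> with \<open>W \<sigma>' = \<tau>\<close> (\<open>vf_less_reach\<close>). Since \<open>\<sigma>\<close> is a
  face of \<open>\<tau>\<close>, that path closes up, and admissibility forces \<open>\<sigma>' = \<sigma>\<close>.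

  The height is monotone along the preorder, and strictly so between inequivalent simplices,
  because the top of a chain may be replaced by, or extended by, a larger simplex. Hence for an
  immediate face \<open>\<sigma>\<close> of \<open>\<tau>\<close> one has \<open>h \<tau> \<le> h \<sigma>\<close> if and only if \<open>W \<sigma> = \<tau>\<close>
  (\<open>vf_height_le_iff\<close>). Both Morse conditions and the equality of the vector fields follow, as \<open>W\<close> is
  a function and is injective where it does not vanish.
\<close>

section \<open>Equivalence along an immediate face\<close>

lemma discrete_vector_fieldD:
  assumes "discrete_vector_field K W" "\<sigma> \<in> K" "W \<sigma> = Some \<tau>"
  shows "\<tau> \<in> K" "immediate_face K \<sigma> \<tau>" "W \<tau> = None"
    and "simplex_dim \<tau> = simplex_dim \<sigma> + 1"
proof -
  show face: "immediate_face K \<sigma> \<tau>" and "W \<tau> = None"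
    using assms unfolding discrete_vector_field_def by blast+
  then show "\<tau> \<in> K" "simplex_dim \<tau> = simplex_dim \<sigma> + 1"
    unfolding immediate_face_def by auto
qed

lemma discrete_vector_field_inj:
  assumes "discrete_vector_field K W" "\<sigma> \<in> K" "\<sigma>' \<in> K" "W \<sigma> = Some \<tau>" "W \<sigma>' = Some \<tau>"
  shows "\<sigma> = \<sigma>'"
  using assms unfolding discrete_vector_field_def by (metis option.distinct(1))

text \<open>
  One step \<open>\<sigma>\<^sub>i, \<sigma>\<^sub>i\<^sub>+\<^sub>1\<close> of a path relative to \<open>W\<close>. The target is not required to lie in the domain
  of \<open>W\<close>, so that the last simplex of a path is treated like the others; on a closed path the
  requirement is automatic.
\<close>

definition vf_step :: "'a set set \<Rightarrow> ('a set \<Rightarrow> 'a set option) \<Rightarrow> 'a set \<Rightarrow> 'a set \<Rightarrow> bool" where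
  "vf_step K W \<sigma> \<sigma>' \<longleftrightarrow>
     \<sigma> \<in> K \<and> \<sigma> \<noteq> \<sigma>' \<and> (\<exists>\<tau>. W \<sigma> = Some \<tau> \<and> immediate_face K \<sigma>' \<tau>)"

lemma vf_step_dim:
  assumes "discrete_vector_field K W" "vf_step K W \<sigma> \<sigma>'"
  shows "simplex_dim \<sigma>' = simplex_dim \<sigma>"
proof -
  from assms(2) obtain \<tau> where "\<sigma> \<in> K" "W \<sigma> = Some \<tau>" "immediate_face K \<sigma>' \<tau>"
    unfolding vf_step_def by blast
  then show ?thesis
    using discrete_vector_fieldD(4)[OF assms(1)] unfolding immediate_face_def by fastforce
qed

lemma admissible_acyclic:
  assumes K: "abstract_simplicial_complex K" and W: "discrete_vector_field K W"
    and adm: "admissible K W"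
  shows "\<not> tranclp (vf_step K W) \<sigma> \<sigma>"
proof
  assume "tranclp (vf_step K W) \<sigma> \<sigma>"
  then obtain r where "r > 0" "(vf_step K W ^^ r) \<sigma> \<sigma>"
    by (auto simp: tranclp_power)
  then obtain s where s: "s 0 = \<sigma>" "s r = \<sigma>" "\<And>i. i < r \<Longrightarrow> vf_step K W (s i) (s (Suc i))"
    by (auto simp: relpowp_fun_conv)
  have "\<sigma> \<in> K"
    using s(1) s(3)[OF \<open>r > 0\<close>] by (simp add: vf_step_def)
  then have "card \<sigma> > 0"
    using K by (auto simp: abstract_simplicial_complex_def card_gt_0_iff)
  then have dim0: "simplex_dim \<sigma> = int (card \<sigma> - 1)"
    unfolding simplex_dim_def by linarith
  have dim: "simplex_dim (s i) = int (card \<sigma> - 1)" if "i \<le> r" for i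
    using that
  proof (induction i)
    case (Suc i)
    then show ?case using vf_step_dim[OF W s(3)[of i]] by simp
  qed (use dim0 s(1) in simp)
  have dom: "s i \<in> K \<and> W (s i) \<noteq> None" if "i \<le> r" for i
  proof (cases "i = r")
    case True
    \<comment> \<open>The last simplex is the first one again, hence the source of a step.\<close>
    then show ?thesis using s(1,2) s(3)[OF \<open>r > 0\<close>] by (auto simp: vf_step_def)
  next
    case False
    then show ?thesis using that s(3)[of i] by (auto simp: vf_step_def)
  qed
  have "vf_path K W (card \<sigma> - 1) r s"
    unfolding vf_path_def using dim dom s(3) by (fastforce simp: vf_step_def)
  then show False
    using adm s(1,2) \<open>r > 0\<close> unfolding admissible_def by metis
qed

text \<open>
  What lies below \<open>\<sigma>\<close> in the preorder: the images under \<open>W\<close> of simplices on paths from \<open>\<sigma>\<close>, the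
  simplices on such paths themselves, simplices of dimension less than that of \<open>\<sigma>\<close>, and simplices of
  the same dimension at which \<open>W\<close> vanishes. This list is closed under descending steps; from the last
  two kinds such steps lead only to each other, so that the dimension of \<open>\<sigma>\<close> is not exceeded again.
\<close>

lemma vf_less_reach:
  assumes W: "discrete_vector_field K W" and "\<sigma> \<in> K" and "vf_less K W \<rho> \<sigma>"
  shows "(\<exists>\<sigma>'. rtranclp (vf_step K W) \<sigma> \<sigma>' \<and> \<sigma>' \<in> K \<and> simplex_dim \<sigma>' = simplex_dim \<sigma> \<and>
              W \<sigma>' = Some \<rho>)
       \<or> (rtranclp (vf_step K W) \<sigma> \<rho> \<and> \<rho> \<in> K \<and> simplex_dim \<rho> = simplex_dim \<sigma>)
       \<or> simplex_dim \<rho> < simplex_dim \<sigma>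
       \<or> (simplex_dim \<rho> = simplex_dim \<sigma> \<and> W \<rho> = None)"
    (is "?P \<rho>")
proof -
  have descend: "?P \<rho>'" if atom: "vf_atomic K W \<rho>' \<rho>" and P: "?P \<rho>" for \<rho> \<rho>'
  proof -
    from atom consider (down) "immediate_face K \<rho>' \<rho>" | (up) "\<rho> \<in> K" "W \<rho> = Some \<rho>'"
      unfolding vf_atomic_def by blast
    then show ?thesis
    proof cases
      case down
      then have down': "\<rho>' \<in> K" "simplex_dim \<rho> = simplex_dim \<rho>' + 1"
        by (simp_all add: immediate_face_def)
      from P consider
          (a) \<sigma>' where "rtranclp (vf_step K W) \<sigma> \<sigma>'" "\<sigma>' \<in> K"
            "simplex_dim \<sigma>' = simplex_dim \<sigma>" "W \<sigma>' = Some \<rho>"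
        | (b) "simplex_dim \<rho> \<le> simplex_dim \<sigma>"
        by (metis order.order_iff_strict)
      then show ?thesis
      proof cases
        case a
        have "vf_step K W \<sigma>' \<rho>' \<or> \<sigma>' = \<rho>'"
          using a down unfolding vf_step_def by blast
        then have "rtranclp (vf_step K W) \<sigma> \<rho>'"
          using a(1) by (auto intro: rtranclp.rtrancl_into_rtrancl)
        moreover have "simplex_dim \<rho>' = simplex_dim \<sigma>"
          using discrete_vector_fieldD(4)[OF W a(2,4)] a(3) down'(2) by simp
        ultimately show ?thesis using down'(1) by blast
      next
        case b
        then show ?thesis using down'(2) by linarith
      qed
    next
      case up
      note up' = discrete_vector_fieldD(3,4)[OF W up]
      from P consider
          (a) \<sigma>' where "\<sigma>' \<in> K" "W \<sigma>' = Some \<rho>"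
        | (b) "rtranclp (vf_step K W) \<sigma> \<rho>" "simplex_dim \<rho> = simplex_dim \<sigma>"
        | (c) "simplex_dim \<rho> < simplex_dim \<sigma>"
        | (d) "W \<rho> = None"
        by (elim disjE exE conjE)
      then show ?thesis
      proof cases
        case a
        then show ?thesis using discrete_vector_fieldD(3)[OF W a] up(2) by simp
      next
        case b
        then show ?thesis using up(1,2) by blast
      next
        case c
        then have "simplex_dim \<rho>' < simplex_dim \<sigma> \<or> simplex_dim \<rho>' = simplex_dim \<sigma>"
          using up'(2) by linarith
        then show ?thesis using up'(1) by blast
      next
        case d
        then show ?thesis using up(2) by simp
      qed
    qed
  qed
  have "tranclp (vf_atomic K W) \<rho> \<sigma>"
    using assms(3) by (simp add: vf_less_def)
  then show ?thesis
  proof (induction rule: converse_tranclp_induct)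
    case (base y)
    then show ?case using descend[of y \<sigma>] \<open>\<sigma> \<in> K\<close> by blast
  next
    case (step y z)
    show ?case using descend[OF step.hyps(1) step.IH] .
  qed
qed

lemma vf_field_iff_less:
  assumes K: "abstract_simplicial_complex K" and W: "discrete_vector_field K W"
    and adm: "admissible K W" and face: "immediate_face K \<sigma> \<tau>"
  shows "W \<sigma> = Some \<tau> \<longleftrightarrow> vf_less K W \<tau> \<sigma>"
proof
  have "\<sigma> \<in> K" and dim: "simplex_dim \<tau> = simplex_dim \<sigma> + 1"
    using face by (auto simp: immediate_face_def)
  show "vf_less K W \<tau> \<sigma>" if "W \<sigma> = Some \<tau>"
    using that \<open>\<sigma> \<in> K\<close> by (auto simp: vf_less_def vf_atomic_def)
  assume "vf_less K W \<tau> \<sigma>"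
  from vf_less_reach[OF W \<open>\<sigma> \<in> K\<close> this] dim
  obtain \<sigma>' where \<sigma>': "rtranclp (vf_step K W) \<sigma> \<sigma>'" "\<sigma>' \<in> K" "W \<sigma>' = Some \<tau>"
    by auto
  have "\<sigma>' = \<sigma>"
  proof (rule ccontr)
    assume "\<sigma>' \<noteq> \<sigma>"
    then have "vf_step K W \<sigma>' \<sigma>"
      using \<sigma>' face by (auto simp: vf_step_def)
    with \<sigma>'(1) have "tranclp (vf_step K W) \<sigma> \<sigma>"
      by (rule rtranclp_into_tranclp1)
    then show False using admissible_acyclic[OF K W adm] by blast
  qed
  then show "W \<sigma> = Some \<tau>" using \<sigma>'(3) by simp
qed

section \<open>Monotonicity of the height\<close>

lemma vf_less_trans: "vf_less K W x y \<Longrightarrow> vf_less K W y z \<Longrightarrow> vf_less K W x z"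
  unfolding vf_less_def by (rule tranclp_trans)

text \<open>The chains of length \<open>n\<close> with top element \<open>\<sigma>\<close> over which the height is a maximum.\<close>

definition vf_chain ::
  "'a set set \<Rightarrow> ('a set \<Rightarrow> 'a set option) \<Rightarrow> 'a set \<Rightarrow> nat \<Rightarrow> (nat \<Rightarrow> 'a set) \<Rightarrow> bool" where
  "vf_chain K W \<sigma> n c \<longleftrightarrow> c n = \<sigma> \<and> (\<forall>i\<le>n. c i \<in> K) \<and>
     (\<forall>i<n. vf_less K W (c i) (c (Suc i)) \<and> \<not> vf_sim K W (c i) (c (Suc i)))"

lemma vf_height_eq_Max: "vf_height K W \<sigma> = Max {n. \<exists>c. vf_chain K W \<sigma> n c}"
  unfolding vf_height_def vf_chain_def ..

lemma vf_chain_less: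
  assumes c: "vf_chain K W \<sigma> n c" and "i < j" "j \<le> n"
  shows "vf_less K W (c i) (c j)"
  using \<open>i < j\<close> \<open>j \<le> n\<close>
proof (induction j)
  case (Suc j)
  have "vf_less K W (c j) (c (Suc j))"
    using c Suc.prems by (auto simp: vf_chain_def)
  then show ?case
    using Suc vf_less_trans by (cases "i = j") (auto simp: less_Suc_eq)
qed simp

lemma vf_chain_inj:
  assumes c: "vf_chain K W \<sigma> n c"
  shows "inj_on c {..n}"
proof (rule linorder_inj_onI')
  fix i j assume "i \<in> {..n}" "j \<in> {..n}" "i < j"
  then have ij: "i < j" "j \<le> n" by auto
  have up: "vf_less K W (c i) (c (Suc i))" and nsim: "\<not> vf_sim K W (c i) (c (Suc i))"
    using c ij by (auto simp: vf_chain_def)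
  show "c i \<noteq> c j"
  proof
    assume eq: "c i = c j"
    then have "vf_less K W (c (Suc i)) (c i)"
      using up vf_chain_less[OF c, of "Suc i" j] ij by (cases "Suc i = j") auto
    then show False using up nsim by (simp add: vf_sim_def)
  qed
qed

lemma finite_vf_chain_lengths:
  assumes "finite K"
  shows "finite {n. \<exists>c. vf_chain K W \<sigma> n c}"
proof (rule finite_subset)
  show "{n. \<exists>c. vf_chain K W \<sigma> n c} \<subseteq> {..card K}"
  proof clarify
    fix n c assume c: "vf_chain K W \<sigma> n c"
    have "card {..n} \<le> card K"
      using vf_chain_inj[OF c] c assms
      by (intro card_inj_on_le[of c]) (auto simp: vf_chain_def)
    then show "n \<le> card K" by simp
  qed
qed simp

lemma vf_chain_length_le_height:
  assumes "finite K" "vf_chain K W \<sigma> n c"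
  shows "n \<le> vf_height K W \<sigma>"
  unfolding vf_height_eq_Max using finite_vf_chain_lengths[OF assms(1)] assms(2)
  by (intro Max_ge) auto

lemma vf_height_chain:
  assumes "finite K" "\<sigma> \<in> K"
  obtains c where "vf_chain K W \<sigma> (vf_height K W \<sigma>) c"
proof -
  have "vf_chain K W \<sigma> 0 (\<lambda>_. \<sigma>)"
    using assms(2) by (simp add: vf_chain_def)
  then have "{n. \<exists>c. vf_chain K W \<sigma> n c} \<noteq> {}" by blast
  from Max_in[OF finite_vf_chain_lengths[OF assms(1)] this] show ?thesis
    using that by (auto simp: vf_height_eq_Max)
qed

lemma vf_height_mono:
  assumes "finite K" "\<sigma> \<in> K" "\<tau> \<in> K" and less: "vf_less K W \<sigma> \<tau>"
  shows "vf_height K W \<sigma> \<le> vf_height K W \<tau>"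
proof -
  let ?n = "vf_height K W \<sigma>"
  obtain c where c: "vf_chain K W \<sigma> ?n c"
    using vf_height_chain[OF assms(1,2)] .
  have "vf_less K W (c i) \<tau> \<and> \<not> vf_sim K W (c i) \<tau>" if "Suc i = ?n" for i
  proof -
    have "c (Suc i) = \<sigma>"
      using c that by (simp add: vf_chain_def)
    moreover have "i < ?n" using that by linarith
    then have "vf_less K W (c i) (c (Suc i)) \<and> \<not> vf_sim K W (c i) (c (Suc i))"
      using c unfolding vf_chain_def by blast
    ultimately have *: "vf_less K W (c i) \<sigma>" "\<not> vf_sim K W (c i) \<sigma>" by simp_all
    moreover have "\<not> vf_less K W \<tau> (c i)"
      using * vf_less_trans[OF less] by (auto simp: vf_sim_def)
    ultimately show ?thesis
      using vf_less_trans[OF _ less] by (auto simp: vf_sim_def)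
  qed
  then have "vf_chain K W \<tau> ?n (c(?n := \<tau>))"
    using c assms(3) by (auto simp: vf_chain_def)
  then show ?thesis
    by (rule vf_chain_length_le_height[OF assms(1)])
qed

lemma vf_height_strict_mono:
  assumes "finite K" "\<sigma> \<in> K" "\<tau> \<in> K"
    and less: "vf_less K W \<sigma> \<tau>" and not_less: "\<not> vf_less K W \<tau> \<sigma>"
  shows "vf_height K W \<sigma> < vf_height K W \<tau>"
proof -
  let ?n = "vf_height K W \<sigma>"
  obtain c where c: "vf_chain K W \<sigma> ?n c"
    using vf_height_chain[OF assms(1,2)] .
  have "vf_chain K W \<tau> (Suc ?n) (c(Suc ?n := \<tau>))"
    using c assms(3) less not_less by (auto simp: vf_chain_def vf_sim_def less_Suc_eq le_Suc_eq)
  then have "Suc ?n \<le> vf_height K W \<tau>"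
    by (rule vf_chain_length_le_height[OF assms(1)])
  then show ?thesis by simp
qed

lemma vf_height_le_iff:
  assumes K: "abstract_simplicial_complex K" "finite K" and W: "discrete_vector_field K W"
    and adm: "admissible K W" and face: "immediate_face K \<sigma> \<tau>"
  shows "vf_height K W \<tau> \<le> vf_height K W \<sigma> \<longleftrightarrow> W \<sigma> = Some \<tau>"
proof -
  have in_K: "\<sigma> \<in> K" "\<tau> \<in> K"
    using face by (auto simp: immediate_face_def)
  have less: "vf_less K W \<sigma> \<tau>"
    using face by (auto simp: vf_less_def vf_atomic_def)
  show ?thesis
    unfolding vf_field_iff_less[OF K(1) W adm face]
    using vf_height_mono[OF K(2) in_K(2,1)] vf_height_strict_mono[OF K(2) in_K less]
    by fastforce
qed

section \<open>The height function and its gradient\<close>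

theorem theorem3:
  fixes K :: "'a set set" and W :: "'a set \<Rightarrow> 'a set option" and h :: "'a set \<Rightarrow> nat"
  assumes "abstract_simplicial_complex K" and "finite K"
    and "discrete_vector_field K W" and "admissible K W"
    and "\<forall>\<sigma>\<in>K. h \<sigma> = vf_height K W \<sigma>"
  shows "combinatorial_morse_function K (\<lambda>\<sigma>. real (h \<sigma>)) \<and>
         (\<forall>\<sigma>\<in>K. gradient_field K (\<lambda>\<sigma>. real (h \<sigma>)) \<sigma> = W \<sigma>)"
proof
  have face_iff: "immediate_face K \<sigma> \<tau> \<and> real (h \<tau>) \<le> real (h \<sigma>) \<longleftrightarrow> \<sigma> \<in> K \<and> W \<sigma> = Some \<tau>"
    for \<sigma> \<tau>
    using vf_height_le_iff[OF assms(1-4), of \<sigma> \<tau>] assms(5) discrete_vector_fieldD(2)[OF assms(3)]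
    by (auto simp: immediate_face_def)
  show "combinatorial_morse_function K (\<lambda>\<sigma>. real (h \<sigma>))"
    unfolding combinatorial_morse_function_def face_iff
  proof (intro ballI conjI)
    fix \<sigma> assume "\<sigma> \<in> K"
    let ?A = "{\<eta>. \<eta> \<in> K \<and> W \<eta> = Some \<sigma>}" and ?B = "{\<tau>. \<sigma> \<in> K \<and> W \<sigma> = Some \<tau>}"
    show fin: "finite ?A" "finite ?B"
      using assms(2) discrete_vector_fieldD(1)[OF assms(3)]
      by (auto intro: finite_subset[of _ K])
    show "card ?A \<le> 1"
      unfolding One_nat_def card_le_Suc0_iff_eq[OF fin(1)]
      using discrete_vector_field_inj[OF assms(3)] by blast
    show "card ?B \<le> 1"
      unfolding One_nat_def card_le_Suc0_iff_eq[OF fin(2)] by simp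
  qed
  show "\<forall>\<sigma>\<in>K. gradient_field K (\<lambda>\<sigma>. real (h \<sigma>)) \<sigma> = W \<sigma>"
    unfolding gradient_field_def face_iff by (auto split: option.splits)
qed

end
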